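(* Let $C\ge 1$ and let $X_1,\ldots,X_n$ be an arbitrary sequence of independent nonnegative random variables (not necessarily identically distributed). For any $\gamma>0$ and for any policy $\mathcal{P}$ that sequentially packs $X_1,\dots,X_n$, there exists a policy $\mathcal{P}'$ sequentially packing the same items such that: (i) every item $X_i$ with $\Pr(X_i>1)>\gamma/C$ is packed by $\mathcal{P}'$ individually (alone in its bin), and every bin not containing such an item has risk at most $\gamma/C$ (so that, if $\Pr(X_i>1)\le\gamma/C$ for all $i$, $\mathcal{P}'$ is a risk-budgeted policy with risk budget $\gamma/C$); and (ii) \[ \mathrm{cost}(\mathcal{P}')\le\left(1+\frac{2}{\gamma}\right)\mathrm{cost}(\mathcal{P}). \]
   Context: Model. $C\ge 1$ is a penalty parameter. The items are independent nonnegative random variables $X_1,\dots,X_n$, with distributions known in advance to the policy, and there are unit-capacity bins $B_1,\dots,B_n$. Items are packed sequentially in the order $1,\dots,n$: at round $i$ a (deterministic) policy chooses the bin $j\in\{1,\dots,n\}$ for item $i$ (written $i\to j$) as a function of the history (the bins chosen for and the realized sizes of items $1,\dots,i-1$); then the size of $X_i$ is revealed. The usage $S_j^{i-1}$ is the sum of the realized sizes of the items among $1,\dots,i-1$ packed into bin $j$. A bin is overflowed (broken) once its usage exceeds $1$; a policy is feasible if it never packs an item into an already overflowed bin, and only feasible policies are considered. A bin is opened when it receives its first item. $N_{\mathcal{P}}$ is the number of bins opened, $O_{\mathcal{P}}$ the number of bins overflowed, and $\mathrm{cost}(\mathcal{P})=\mathbf{E}[N_{\mathcal{P}}]+C\,\mathbf{E}[O_{\mathcal{P}}]$.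 The risk of bin $B_j$ under a policy is the random variable $\mathrm{Risk}(B_j)=\sum_{i=1}^n \Pr_{X_i}(X_i+S_j^{i-1}>1)\,\mathbf{1}_{\{i\to j\}}$, where $\Pr_{X_i}$ is probability over $X_i$ only, with $S_j^{i-1}$ fixed. A policy is risk-budgeted with risk budget $r>0$ if $\mathrm{Risk}(B_j)\le r$ for every $j$. *)

theory Defs
  imports "HOL-Probability.Probability"
begin

text \<open>
  Items and bins are both indexed by \<open>{1..n}\<close>. The history before round \<open>i\<close> is the pair of the bins
  chosen for, and the sizes of, the items \<open>1, \<dots>, i - 1\<close>. Policies are required to be measurable
  functions of the history, so that the numbers of opened and of overflowed bins are random
  variables and their expectations are meaningful.
\<close>

type_synonym history = "(nat \<Rightarrow> nat) \<times> (nat \<Rightarrow> real)"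
type_synonym policy = "nat \<Rightarrow> history \<Rightarrow> nat"

definition history_space :: "nat \<Rightarrow> nat \<Rightarrow> history measure" where
  "history_space n i =
     PiM {1..<i} (\<lambda>_. count_space {1..n}) \<Otimes>\<^sub>M PiM {1..<i} (\<lambda>_. borel)"

definition is_policy :: "nat \<Rightarrow> policy \<Rightarrow> bool" where
  "is_policy n P \<longleftrightarrow> (\<forall>i\<in>{1..n}. P i \<in> history_space n i \<rightarrow>\<^sub>M count_space {1..n})"

text \<open>The bin receiving item \<open>i\<close> when \<open>P\<close> is run on the realized sizes \<open>x 1, x 2, \<dots>\<close>\<close>

lemma restrict_fundef_cong [fundef_cong]:
  "A = B \<Longrightarrow> (\<And>k. k \<in> B \<Longrightarrow> f k = g k) \<Longrightarrow> restrict f A = restrict g B"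
  by (auto simp: restrict_def)

fun bin_of :: "policy \<Rightarrow> (nat \<Rightarrow> real) \<Rightarrow> nat \<Rightarrow> nat" where
  "bin_of P x i = P i (\<lambda>k\<in>{1..<i}. bin_of P x k, \<lambda>k\<in>{1..<i}. x k)"

declare bin_of.simps [simp del]

text \<open>\<open>usage P x k j\<close> is $S_j^k$: the usage of bin \<open>j\<close> after the first \<open>k\<close> rounds.\<close>

definition usage :: "policy \<Rightarrow> (nat \<Rightarrow> real) \<Rightarrow> nat \<Rightarrow> nat \<Rightarrow> real" where
  "usage P x k j = (\<Sum>l\<in>{l\<in>{1..k}. bin_of P x l = j}. x l)"

definition num_opened :: "nat \<Rightarrow> policy \<Rightarrow> (nat \<Rightarrow> real) \<Rightarrow> nat" where
  "num_opened n P x = card {j\<in>{1..n}. \<exists>i\<in>{1..n}. bin_of P x i = j}"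

definition num_overflowed :: "nat \<Rightarrow> policy \<Rightarrow> (nat \<Rightarrow> real) \<Rightarrow> nat" where
  "num_overflowed n P x = card {j\<in>{1..n}. usage P x n j > 1}"

definition feasible :: "'a measure \<Rightarrow> (nat \<Rightarrow> 'a \<Rightarrow> real) \<Rightarrow> nat \<Rightarrow> policy \<Rightarrow> bool" where
  "feasible M X n P \<longleftrightarrow>
     (\<forall>\<omega>\<in>space M. \<forall>i\<in>{1..n}.
        \<not> usage P (\<lambda>k. X k \<omega>) (i - 1) (bin_of P (\<lambda>k. X k \<omega>) i) > 1)"

definition cost :: "'a measure \<Rightarrow> (nat \<Rightarrow> 'a \<Rightarrow> real) \<Rightarrow> nat \<Rightarrow> real \<Rightarrow> policy \<Rightarrow> real" where
  "cost M X n C P =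
     (\<integral>\<omega>. real (num_opened n P (\<lambda>k. X k \<omega>)) \<partial>M)
     + C * (\<integral>\<omega>. real (num_overflowed n P (\<lambda>k. X k \<omega>)) \<partial>M)"

text \<open>
  The risk of bin \<open>j\<close> on the realized sizes \<open>x\<close>: the probability is taken over a fresh outcome
  \<open>\<omega>\<close> of item \<open>i\<close> only, the usage being the one determined by \<open>x\<close>.
\<close>

definition risk ::
    "'a measure \<Rightarrow> (nat \<Rightarrow> 'a \<Rightarrow> real) \<Rightarrow> nat \<Rightarrow> policy \<Rightarrow> (nat \<Rightarrow> real) \<Rightarrow> nat \<Rightarrow> real" where
  "risk M X n P x j =
     (\<Sum>i\<in>{1..n}. \<P>(\<omega> in M. X i \<omega> + usage P x (i - 1) j > 1) * of_bool (bin_of P x i = j))"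

definition risk_budgeted ::
    "'a measure \<Rightarrow> (nat \<Rightarrow> 'a \<Rightarrow> real) \<Rightarrow> nat \<Rightarrow> real \<Rightarrow> policy \<Rightarrow> bool" where
  "risk_budgeted M X n r P \<longleftrightarrow>
     0 < r \<and> (\<forall>\<omega>\<in>space M. \<forall>j\<in>{1..n}. risk M X n P (\<lambda>k. X k \<omega>) j \<le> r)"

end

theory Submission
  imports Defs
begin

text \<open>
  Write \<open>r = \<gamma> / C\<close> and \<open>q i u = Pr(X i + u > 1)\<close>, and call item \<open>i\<close> heavy if \<open>q i 0 > r\<close> and light
  otherwise. The policy \<open>P'\<close> simulates \<open>P\<close> and splits each bin of \<open>P\<close> by next fit: heavy items are
  packed alone, and a light item joins the sub-bin of the latest light item that \<open>P\<close> put in the same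
  bin, unless the risk of that sub-bin would then exceed \<open>r\<close>, in which case it opens a new sub-bin.
  The simulation needs only the realized sizes, since these determine all decisions of \<open>P\<close>.
  The risk bounds on \<open>P'\<close> hold by construction; what has to be shown concerns the cost.

  \<^item> Overflows (\<open>overflow_count\<close>). The content of a sub-bin is part of the content of a bin of \<open>P\<close>.
    As \<open>P\<close> is feasible, \<open>P'\<close> is feasible too, and only the last item of a bin can make it overflow.
    Hence each bin has at most one overflowed sub-bin, and then overflows itself, so pointwise \<open>P'\<close>
    has no more overflowed bins than \<open>P\<close>.

  \<^item> Opened bins (\<open>open_count\<close>). Let \<open>\<rho> i\<close> be the risk that \<open>P\<close> takes with item \<open>i\<close>. It is at least the
    risk of the same item under \<open>P'\<close>, because loads of sub-bins are smaller. A heavy item has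
    \<open>\<rho> i > r\<close>. A light item that opens a sub-bin after an earlier one was closed satisfies
    \<open>(\<Sum>k\<in>S. \<rho> k) + \<rho> i > r\<close> for the closed sub-bin \<open>S\<close>. Each item is charged at most twice, once as a
    member of a closed sub-bin and once as an opener, so \<open>P'\<close> opens at most \<open>2 / r * (\<Sum>i. \<rho> i)\<close> bins
    beyond those opened by \<open>P\<close>.

  \<^item> Risk against overflow (\<open>expected_risk_le_expected_overflow\<close>). The size of item \<open>i\<close> is independent of
    the history, so \<open>\<rho> i\<close> has the same expectation as the indicator that item \<open>i\<close> makes its bin overflow.
    A bin of a feasible policy is made to overflow at most once, hence \<open>E (\<Sum>i. \<rho> i) \<le> E O\<close>.

  Together \<open>cost P' \<le> E N + 2 C / \<gamma> * E O + C * E O \<le> (1 + 2 / \<gamma>) * cost P\<close>, where \<open>N\<close> and \<open>O\<close> are the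
  numbers of opened and of overflowed bins of \<open>P\<close>.
\<close>

section \<open>Next-fit splitting of a packing\<close>

text \<open>
  This is the usage of a bin for an arbitrary assignment \<open>b\<close> of items to bins. The counting below
  compares two assignments and does not depend on where they come from.
\<close>

definition load :: "(nat \<Rightarrow> nat) \<Rightarrow> (nat \<Rightarrow> real) \<Rightarrow> nat \<Rightarrow> nat \<Rightarrow> real" where
  "load b x k j = (\<Sum>l\<in>{l\<in>{1..k}. b l = j}. x l)"

text \<open>
  One decision of next fit for item \<open>i\<close>: \<open>a\<close> is the packing that is refined and \<open>b\<close> the sub-bins chosen
  so far. A sub-bin is named by the item that opens it. These names are at most \<open>n\<close> and never clash,
  so the refined packing uses the same supply of \<open>n\<close> bins.
\<close>

definition next_fit ::
    "(nat \<Rightarrow> real \<Rightarrow> real) \<Rightarrow> real \<Rightarrow> nat \<Rightarrow> (nat \<Rightarrow> nat) \<Rightarrow> (nat \<Rightarrow> nat) \<Rightarrow> (nat \<Rightarrow> real) \<Rightarrow> nat" where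
  "next_fit q r i a b x =
     (let F = {k\<in>{1..<i}. q k 0 \<le> r \<and> a k = a i}; c = b (Max F) in
      if q i 0 \<le> r \<and> F \<noteq> {} \<and>
         (\<Sum>k\<in>{k\<in>{1..<i}. b k = c}. q k (load b x (k - 1) c)) + q i (load b x (i - 1) c) \<le> r
      then c else i)"

lemma load_cong:
  assumes "\<And>l. l \<in> {1..k} \<Longrightarrow> b l = b' l" and "\<And>l. l \<in> {1..k} \<Longrightarrow> x l = x' l"
  shows "load b x k j = load b' x' k j"
proof -
  have "{l\<in>{1..k}. b l = j} = {l\<in>{1..k}. b' l = j}" using assms by auto
  then show ?thesis unfolding load_def using assms by (intro sum.cong) auto
qed

text \<open>
  The decision for item \<open>i\<close> depends on the history only: on the choices of the refined packing up to
  and including round \<open>i\<close>, which precede the revelation of the size of item \<open>i\<close>, and on sub-bins and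
  sizes of earlier rounds.
\<close>

lemma next_fit_cong:
  assumes a: "\<And>k. k \<in> {1..i} \<Longrightarrow> a k = a' k"
    and b: "\<And>k. k \<in> {1..<i} \<Longrightarrow> b k = b' k"
    and x: "\<And>k. k \<in> {1..<i} \<Longrightarrow> x k = x' k"
    and i: "1 \<le> i"
  shows "next_fit q r i a b x = next_fit q r i a' b' x'"
proof -
  define F where "F = {k\<in>{1..<i}. q k 0 \<le> r \<and> a k = a i}"
  have F': "{k\<in>{1..<i}. q k 0 \<le> r \<and> a' k = a' i} = F"
    unfolding F_def using a i by auto
  show ?thesis
  proof (cases "F = {}")
    case True
    then show ?thesis
      unfolding next_fit_def F_def[symmetric] F' by (simp add: Let_def)
  next
    case False
    have "Max F \<in> F" using False by (intro Max_in) (auto simp: F_def)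
    then have M: "b' (Max F) = b (Max F)" using b by (auto simp: F_def)
    have L: "load b' x' (k - 1) c = load b x (k - 1) c" if "k \<in> {1..i}" for k c
      using that by (intro load_cong) (auto simp: b x)
    have S: "{k\<in>{1..<i}. b' k = c} = {k\<in>{1..<i}. b k = c}" for c
      using b by auto
    have R: "(\<Sum>k\<in>{k\<in>{1..<i}. b k = c}. q k (load b' x' (k - 1) c))
        = (\<Sum>k\<in>{k\<in>{1..<i}. b k = c}. q k (load b x (k - 1) c))" for c
    proof (rule sum.cong)
      fix k assume "k \<in> {k\<in>{1..<i}. b k = c}"
      then have "k \<in> {1..i}" by auto
      from L[OF this] show "q k (load b' x' (k - 1) c) = q k (load b x (k - 1) c)" by metis
    qed simp
    have Li: "load b' x' (i - 1) c = load b x (i - 1) c" for c using L i by simp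
    show ?thesis
      unfolding next_fit_def F_def[symmetric] F' Let_def M S R Li ..
  qed
qed

text \<open>
  A single realization \<open>x\<close> of the sizes: \<open>a\<close> is the packing to be refined and \<open>b\<close> its next-fit splitting
  with risk functions \<open>q\<close> and risk bound \<open>r\<close>. All statements in this context are deterministic.
\<close>

locale next_fit_splitting =
  fixes n :: nat and a b :: "nat \<Rightarrow> nat" and x :: "nat \<Rightarrow> real"
    and q :: "nat \<Rightarrow> real \<Rightarrow> real" and r :: real
  assumes x_nonneg: "i \<in> {1..n} \<Longrightarrow> 0 \<le> x i"
    and q_nonneg: "0 \<le> q i u"
    and q_mono: "i \<in> {1..n} \<Longrightarrow> u \<le> v \<Longrightarrow> q i u \<le> q i v"
    and r_pos: "0 < r"
    and b_next_fit: "i \<in> {1..n} \<Longrightarrow> b i = next_fit q r i a b x"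
begin

definition earlier :: "nat \<Rightarrow> nat set" where
  "earlier i = {k\<in>{1..<i}. q k 0 \<le> r \<and> a k = a i}"

lemma earlierI: "1 \<le> k \<Longrightarrow> k < i \<Longrightarrow> q k 0 \<le> r \<Longrightarrow> a k = a i \<Longrightarrow> k \<in> earlier i"
  by (simp add: earlier_def)

lemma le_Max_earlier: "k \<in> earlier i \<Longrightarrow> k \<le> Max (earlier i)"
  by (intro Max_ge) (auto simp: earlier_def)

lemma Max_earlier:
  assumes "earlier i \<noteq> {}"
  shows "Max (earlier i) \<in> {1..<i}" "q (Max (earlier i)) 0 \<le> r" "a (Max (earlier i)) = a i"
proof -
  have "Max (earlier i) \<in> earlier i"
    using assms by (intro Max_in) (auto simp: earlier_def)
  then show "Max (earlier i) \<in> {1..<i}" "q (Max (earlier i)) 0 \<le> r" "a (Max (earlier i)) = a i"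
    unfolding earlier_def by blast+
qed

lemma b_cases:
  assumes "i \<in> {1..n}"
  obtains (join) "q i 0 \<le> r" "earlier i \<noteq> {}" "b i = b (Max (earlier i))"
      "(\<Sum>k\<in>{k\<in>{1..<i}. b k = b i}. q k (load b x (k - 1) (b i))) + q i (load b x (i - 1) (b i)) \<le> r"
    | (heavy) "q i 0 > r" "b i = i"
    | (first) "q i 0 \<le> r" "earlier i = {}" "b i = i"
    | (closed) "q i 0 \<le> r" "earlier i \<noteq> {}" "b i = i"
      "(\<Sum>k\<in>{k\<in>{1..<i}. b k = b (Max (earlier i))}. q k (load b x (k - 1) (b (Max (earlier i)))))
        + q i (load b x (i - 1) (b (Max (earlier i)))) > r"
proof -
  define F where "F = earlier i"
  define R where "R c = (\<Sum>k\<in>{k\<in>{1..<i}. b k = c}. q k (load b x (k - 1) c))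
    + q i (load b x (i - 1) c)" for c
  have eq: "b i = (if q i 0 \<le> r \<and> F \<noteq> {} \<and> R (b (Max F)) \<le> r then b (Max F) else i)"
    using b_next_fit[OF assms] unfolding next_fit_def F_def earlier_def Let_def R_def .
  show thesis
  proof (cases "q i 0 \<le> r \<and> F \<noteq> {} \<and> R (b (Max F)) \<le> r")
    case True
    with eq have "b i = b (Max F)" by simp
    with True join show thesis unfolding F_def R_def by metis
  next
    case False
    with eq have "b i = i" by simp
    with False heavy first closed show thesis unfolding F_def R_def not_le[symmetric] by blast
  qed
qed

text \<open>
  The item that names a sub-bin belongs to it, lies in the same bin of the refined packing, and is
  light as soon as a second item joins. Thus sub-bins refine bins and heavy items stay alone.
\<close>

lemma b_structure:
  assumes "i \<in> {1..n}"
  shows "b i \<in> {1..i} \<and> b (b i) = b i \<and> a (b i) = a i \<and>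
    (b i \<noteq> i \<longrightarrow> q i 0 \<le> r \<and> q (b i) 0 \<le> r)"
  using assms
proof (induction i rule: less_induct)
  case (less i)
  from less.prems show ?case
  proof (cases rule: b_cases)
    case join
    let ?m = "Max (earlier i)"
    note m = Max_earlier[OF join(2)]
    have "?m < i" "?m \<in> {1..n}" using m less.prems by auto
    from less.IH[OF this] join m show ?thesis
      by (cases "b ?m = ?m") auto
  qed (use less.prems in auto)
qed

lemmas b_range = b_structure[THEN conjunct1]
  and b_idem = b_structure[THEN conjunct2, THEN conjunct1]
  and a_b = b_structure[THEN conjunct2, THEN conjunct2, THEN conjunct1]

lemma a_eq_if_b_eq: "i \<in> {1..n} \<Longrightarrow> k \<in> {1..n} \<Longrightarrow> b i = b k \<Longrightarrow> a i = a k"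
  using a_b by metis

lemma heavy_alone:
  assumes "i \<in> {1..n}" "k \<in> {1..n}" "k \<noteq> i" "q i 0 > r"
  shows "b k \<noteq> b i"
proof
  assume eq: "b k = b i"
  have "b i = i" using b_structure[OF assms(1)] assms(4) by linarith
  with eq assms b_structure[OF assms(2)] show False by (metis not_le)
qed

text \<open>
  Next fit never returns to a closed sub-bin: among the light items of one bin of \<open>a\<close>, sub-bins are
  used in the order in which they are opened. This is what makes the sub-bins closed by different
  openers different.
\<close>

lemma b_mono:
  assumes "m \<in> {1..n}" "i \<in> {1..m}" "q i 0 \<le> r" "q m 0 \<le> r" "a i = a m"
  shows "b i \<le> b m"
  using assms
proof (induction m rule: less_induct)
  case (less m)
  show ?case
  proof (cases "i = m")
    case False
    with less.prems have i: "i \<in> earlier m" by (intro earlierI) auto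
    from less.prems(1) show ?thesis
    proof (cases rule: b_cases)
      case join
      let ?m = "Max (earlier m)"
      note m = Max_earlier[OF join(2)]
      have "i \<le> ?m" using i by (rule le_Max_earlier)
      with less.IH[of ?m] m less.prems join(3) show ?thesis by auto
    next
      case heavy
      with less.prems show ?thesis by simp
    next
      case first
      with i show ?thesis by blast
    next
      case closed
      with less.prems b_range[of i] show ?thesis by auto
    qed
  qed simp
qed

lemma load_refine:
  assumes "k \<le> n" "i \<in> {1..n}"
  shows "load b x k (b i) \<le> load a x k (a i)"
  unfolding load_def
proof (rule sum_mono2)
  show "{l\<in>{1..k}. b l = b i} \<subseteq> {l\<in>{1..k}. a l = a i}"
    using assms by (auto intro: a_eq_if_b_eq)
qed (use assms in \<open>auto intro!: x_nonneg\<close>)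

lemma load_nonneg: "k \<le> n \<Longrightarrow> 0 \<le> load d x k j"
  unfolding load_def by (intro sum_nonneg) (auto intro!: x_nonneg)

text \<open>
  The opener of a light sub-bin meets load \<open>0\<close> and contributes at most \<open>r\<close> because it is light; every
  later item joins only if the bound survives.
\<close>

lemma risk_sub_bin:
  assumes "m \<le> n" and "\<And>i. i \<in> {1..n} \<Longrightarrow> b i = c \<Longrightarrow> q i 0 \<le> r"
  shows "(\<Sum>k\<in>{k\<in>{1..m}. b k = c}. q k (load b x (k - 1) c)) \<le> r"
  using assms(1)
proof (induction m)
  case 0
  then show ?case using r_pos by simp
next
  case (Suc m)
  have m: "Suc m \<in> {1..n}" using Suc.prems by auto
  have m': "{1..<Suc m} = {1..m}" by auto
  show ?case
  proof (cases "b (Suc m) = c")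
    case False
    then have "{k\<in>{1..Suc m}. b k = c} = {k\<in>{1..m}. b k = c}"
      by (auto simp: le_Suc_eq)
    with Suc show ?thesis by simp
  next
    case True
    then have "{k\<in>{1..Suc m}. b k = c} = insert (Suc m) {k\<in>{1..m}. b k = c}"
      by auto
    then have split: "(\<Sum>k\<in>{k\<in>{1..Suc m}. b k = c}. q k (load b x (k - 1) c))
        = (\<Sum>k\<in>{k\<in>{1..m}. b k = c}. q k (load b x (k - 1) c)) + q (Suc m) (load b x m c)"
      by simp
    have light: "q (Suc m) 0 \<le> r" using assms(2)[OF m True] .
    have opened: ?thesis if "b (Suc m) = Suc m"
    proof -
      have e: "{k\<in>{1..m}. b k = c} = {}"
        using that True b_range Suc.prems by fastforce
      then have "load b x m c = 0" unfolding load_def by (metis sum.empty)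
      then show ?thesis unfolding split e using light by simp
    qed
    from m show ?thesis
    proof (cases rule: b_cases)
      case join
      then show ?thesis unfolding split True m' by simp
    qed (use opened light in auto)
  qed
qed

definition openers :: "nat set" where
  "openers = {i\<in>{1..n}. b i = i}"

lemma image_b: "b ` {1..n} = openers"
proof (intro equalityI subsetI)
  fix c assume "c \<in> b ` {1..n}"
  then obtain i where i: "i \<in> {1..n}" "c = b i" by blast
  with b_range[OF i(1)] b_idem[OF i(1)] show "c \<in> openers" by (simp add: openers_def)
next
  fix c assume "c \<in> openers"
  then show "c \<in> b ` {1..n}" unfolding openers_def by (metis (mono_tags) imageI mem_Collect_eq)
qed

text \<open>
  Up to the round before the last item of bin \<open>j\<close>, feasibility keeps the load of \<open>j\<close>, and so that of
  each of its sub-bins, at most \<open>1\<close>. An overflowed sub-bin of \<open>j\<close> is therefore the one that contains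
  the last item of \<open>j\<close>, and mapping overflowed sub-bins to their bins is injective.
\<close>

lemma overflow_count:
  assumes feas: "\<And>i. i \<in> {1..n} \<Longrightarrow> load a x (i - 1) (a i) \<le> 1"
    and a_range: "\<And>i. i \<in> {1..n} \<Longrightarrow> a i \<in> {1..n}"
  shows "card {c\<in>{1..n}. load b x n c > 1} \<le> card {j\<in>{1..n}. load a x n j > 1}"
proof (rule card_inj_on_le)
  have used: "c \<in> {1..n} \<and> b c = c" if "load b x n c > 1" for c
  proof -
    have "{l\<in>{1..n}. b l = c} \<noteq> {}"
      using that unfolding load_def by (metis not_one_less_zero sum.empty)
    then obtain l where l: "l \<in> {1..n}" "b l = c" by blast
    with b_range[OF l(1)] b_idem[OF l(1)] show ?thesis by simp
  qed
  define last where "last j = Max {l\<in>{1..n}. a l = j}" for j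
  have last: "b (last (a c)) = c" if c: "load b x n c > 1" for c
  proof (rule ccontr)
    define m where "m = last (a c)"
    assume "b (last (a c)) \<noteq> c"
    then have neq: "b m \<noteq> c" by (simp add: m_def)
    have "m \<in> {l\<in>{1..n}. a l = a c}"
      unfolding m_def last_def using used[OF c] by (intro Max_in) auto
    then have m: "m \<in> {1..n}" "a m = a c" by auto
    have "l \<le> m - 1" if l: "l \<in> {1..n}" "b l = c" for l
    proof -
      have "a l = a c" using a_b[OF l(1)] l(2) by simp
      then have "l \<le> m" unfolding m_def last_def using l by (intro Max_ge) auto
      moreover have "l \<noteq> m" using l neq by auto
      ultimately show ?thesis by simp
    qed
    then have "{l\<in>{1..n}. b l = c} = {l\<in>{1..m - 1}. b l = c}"
      using m by fastforce
    then have "load b x n c = load b x (m - 1) c" unfolding load_def by metis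
    also have "\<dots> \<le> load a x (m - 1) (a c)"
      using load_refine[of "m - 1" c] used[OF c] m by auto
    also have "\<dots> \<le> 1" using feas[of m] m by auto
    finally show False using c by simp
  qed
  show "inj_on a {c\<in>{1..n}. load b x n c > 1}"
  proof (rule inj_onI)
    fix c d assume "c \<in> {c\<in>{1..n}. load b x n c > 1}" "d \<in> {c\<in>{1..n}. load b x n c > 1}"
      and eq: "a c = a d"
    then have "b (last (a c)) = c" "b (last (a d)) = d" using last by blast+
    then show "c = d" unfolding eq by (rule trans[OF sym])
  qed
  show "a ` {c\<in>{1..n}. load b x n c > 1} \<subseteq> {j\<in>{1..n}. load a x n j > 1}"
  proof (intro image_subsetI CollectI conjI)
    fix c assume "c \<in> {c\<in>{1..n}. load b x n c > 1}"
    then have c: "c \<in> {1..n}" "load b x n c > 1" by auto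
    from a_range[OF c(1)] show "a c \<in> {1..n}" .
    from load_refine[OF order_refl c(1)] used[OF c(2)] c(2) show "load a x n (a c) > 1" by simp
  qed
qed simp

text \<open>
  Closed sub-bins of different openers are disjoint sets of light items, so charging \<open>r\<close> for every
  opener to the risk of the closed sub-bin and of the opener uses each light item at most twice; a
  heavy item pays for itself. Only the first light items of the bins are not paid for by risk, and
  there is at most one of them in each bin of \<open>a\<close>.
\<close>

lemma open_count:
  "r * card openers \<le> r * card (a ` {1..n}) + 2 * (\<Sum>i\<in>{1..n}. q i (load a x (i - 1) (a i)))"
proof -
  define \<rho> where "\<rho> i = q i (load a x (i - 1) (a i))" for i
  \<comment> \<open>The openers are heavy items \<open>H\<close>, the first light items \<open>F\<close> of their bins, and the light items \<open>T\<close>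
     that find the current sub-bin \<open>c i\<close> of their bin too risky.\<close>
  define H where "H = {i\<in>{1..n}. q i 0 > r}"
  define F where "F = {i\<in>{1..n}. q i 0 \<le> r \<and> earlier i = {}}"
  define T where "T = {i\<in>openers. q i 0 \<le> r \<and> earlier i \<noteq> {}}"
  define c where "c i = b (Max (earlier i))" for i
  have fin: "finite H" "finite F" "finite T"
    unfolding H_def F_def T_def openers_def by auto
  have T_sub: "T \<subseteq> {1..n}" unfolding T_def openers_def by auto
  have \<rho>_nonneg: "0 \<le> \<rho> i" for i unfolding \<rho>_def by (rule q_nonneg)
  have "openers \<subseteq> H \<union> F \<union> T"
    unfolding H_def F_def T_def openers_def by auto
  then have "card openers \<le> card (H \<union> F \<union> T)"
    using fin by (intro card_mono) auto
  also have "\<dots> \<le> card H + card F + card T"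
    by (meson add_mono_thms_linordered_semiring(3) card_Un_le le_trans)
  finally have total: "card openers \<le> card H + card F + card T" .

  have "inj_on a F"
  proof (rule linorder_inj_onI)
    fix i k assume ik: "i < k" "i \<in> F" "k \<in> F"
    show "a i \<noteq> a k"
    proof
      assume "a i = a k"
      with ik have "i \<in> earlier k" by (intro earlierI) (auto simp: F_def)
      with ik show False by (auto simp: F_def)
    qed
  qed auto
  then have F: "card F \<le> card (a ` {1..n})"
    by (intro card_inj_on_le) (auto simp: F_def)

  have "r * card H = (\<Sum>i\<in>H. r)" by simp
  also have "\<dots> \<le> (\<Sum>i\<in>H. \<rho> i)"
  proof (rule sum_mono)
    fix i assume i: "i \<in> H"
    then have "0 \<le> load a x (i - 1) (a i)" by (intro load_nonneg) (auto simp: H_def)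
    with q_mono[of i 0 "load a x (i - 1) (a i)"] i show "r \<le> \<rho> i"
      unfolding H_def \<rho>_def by auto
  qed
  finally have H: "r * card H \<le> (\<Sum>i\<in>H. \<rho> i)" .

  have c_lt: "c i < i \<and> a (c i) = a i" if "i \<in> T" for i
  proof -
    have "earlier i \<noteq> {}" "i \<in> {1..n}" using that unfolding T_def openers_def by auto
    note m = Max_earlier[OF this(1)]
    have m': "Max (earlier i) \<in> {1..n}" using m \<open>i \<in> {1..n}\<close> by auto
    show ?thesis using m b_range[OF m'] a_b[OF m'] unfolding c_def by auto
  qed
  \<comment> \<open>After \<open>i\<close> has opened a sub-bin, the light items of its bin only use sub-bins with names \<open>\<ge> i\<close>,
     whereas the sub-bin closed by \<open>i\<close> has a name \<open>< i\<close>.\<close>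
  have "inj_on c T"
  proof (rule linorder_inj_onI)
    fix i k assume ik: "i < k" "i \<in> T" "k \<in> T"
    show "c i \<noteq> c k"
    proof
      assume eq: "c i = c k"
      then have aa: "a i = a k" using c_lt ik by metis
      have i: "i \<in> {1..n}" "q i 0 \<le> r" "b i = i" and k: "k \<in> {1..n}" "earlier k \<noteq> {}"
        using ik by (auto simp: T_def openers_def)
      have "i \<in> earlier k" using i ik aa by (intro earlierI) auto
      then have "i \<le> Max (earlier k)" by (rule le_Max_earlier)
      with b_mono[of "Max (earlier k)" i] Max_earlier[OF k(2)] i k aa have "i \<le> c k"
        unfolding c_def by auto
      with eq c_lt[OF ik(2)] show False by simp
    qed
  qed auto
  have T_charge: "r \<le> (\<Sum>k\<in>{k\<in>{1..n} - H. b k = c i}. \<rho> k) + \<rho> i" if "i \<in> T" for i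
  proof -
    have i: "i \<in> {1..n}" "b i = i" "q i 0 \<le> r" "earlier i \<noteq> {}"
      using that by (auto simp: T_def openers_def)
    note m = Max_earlier[OF i(4)]
    let ?m = "Max (earlier i)"
    have mn: "?m \<in> {1..n}" using m i by auto
    have ci: "c i = b ?m" by (simp add: c_def)
    have light: "q k 0 \<le> r" if "k \<in> {1..n}" "b k = c i" for k
      using heavy_alone[of k ?m] mn m(2) that ci by (cases "k = ?m") force+
    have refine: "q k (load b x (k - 1) (c i)) \<le> \<rho> k" if "k \<in> {1..n}" "a k = a i" for k
      unfolding \<rho>_def using load_refine[of "k - 1" ?m] that mn m(3) ci
      by (intro q_mono) auto
    have "(\<Sum>k\<in>{k\<in>{1..<i}. b k = c i}. q k (load b x (k - 1) (c i)))
        + q i (load b x (i - 1) (c i)) > r"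
      using i(1)
    proof (cases rule: b_cases)
      case join
      with c_lt[OF that] i(2) ci show ?thesis by simp
    qed (use i in \<open>auto simp: c_def\<close>)
    moreover have "(\<Sum>k\<in>{k\<in>{1..<i}. b k = c i}. q k (load b x (k - 1) (c i)))
        \<le> (\<Sum>k\<in>{k\<in>{1..<i}. b k = c i}. \<rho> k)"
    proof (rule sum_mono)
      fix k assume "k \<in> {k\<in>{1..<i}. b k = c i}"
      with i have "k \<in> {1..n}" "b k = b ?m" using ci by auto
      with a_eq_if_b_eq[OF _ mn] m(3) refine show "q k (load b x (k - 1) (c i)) \<le> \<rho> k" by auto
    qed
    moreover have "\<dots> \<le> (\<Sum>k\<in>{k\<in>{1..n} - H. b k = c i}. \<rho> k)"
      using i light by (intro sum_mono2) (auto simp: H_def \<rho>_nonneg not_less)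
    moreover have "q i (load b x (i - 1) (c i)) \<le> \<rho> i"
      using refine i by auto
    ultimately show ?thesis by linarith
  qed
  have "r * card T = (\<Sum>i\<in>T. r)" by simp
  also have "\<dots> \<le> (\<Sum>i\<in>T. (\<Sum>k\<in>{k\<in>{1..n} - H. b k = c i}. \<rho> k) + \<rho> i)"
    by (intro sum_mono T_charge)
  also have "\<dots> = (\<Sum>i\<in>T. \<Sum>k\<in>{k\<in>{1..n} - H. b k = c i}. \<rho> k) + (\<Sum>i\<in>T. \<rho> i)"
    by (rule sum.distrib)
  also have "(\<Sum>i\<in>T. \<Sum>k\<in>{k\<in>{1..n} - H. b k = c i}. \<rho> k)
      = (\<Sum>d\<in>c ` T. \<Sum>k\<in>{k\<in>{1..n} - H. b k = d}. \<rho> k)"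
    using \<open>inj_on c T\<close> by (simp add: sum.reindex)
  also have "\<dots> = sum \<rho> (\<Union>d\<in>c ` T. {k\<in>{1..n} - H. b k = d})"
    using fin by (intro sum.UNION_disjoint[symmetric]) auto
  also have "\<dots> \<le> sum \<rho> ({1..n} - H)"
    by (intro sum_mono2) (auto simp: \<rho>_nonneg)
  also have "sum \<rho> T \<le> sum \<rho> ({1..n} - H)"
    using T_sub by (intro sum_mono2) (auto simp: \<rho>_nonneg T_def H_def)
  finally have T: "r * card T \<le> 2 * sum \<rho> ({1..n} - H)" by simp

  have "r * card openers \<le> r * (card H + card F + card T)"
    using total r_pos by (intro mult_left_mono) (auto simp del: of_nat_add simp: of_nat_add[symmetric])
  also have "\<dots> = r * card H + r * card F + r * card T" by (simp add: algebra_simps)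
  also have "\<dots> \<le> sum \<rho> H + r * card (a ` {1..n}) + 2 * sum \<rho> ({1..n} - H)"
    using H T F r_pos by (intro add_mono mult_left_mono) auto
  also have "\<dots> \<le> r * card (a ` {1..n}) + 2 * (sum \<rho> ({1..n} - H) + sum \<rho> H)"
    using sum_nonneg[of H \<rho>] \<rho>_nonneg by simp
  also have "sum \<rho> ({1..n} - H) + sum \<rho> H = sum \<rho> {1..n}"
    by (rule sum.subset_diff[symmetric]) (auto simp: H_def)
  finally show ?thesis unfolding \<rho>_def .
qed


end

section \<open>Expected risk and overflow\<close>

text \<open>
  Once an item has pushed its bin above \<open>1\<close>, loads only grow and feasibility excludes any further item
  in this bin, so distinct items that cause an overflow lie in distinct bins.
\<close>

lemma crossings_le_overflowed:
  fixes x :: "nat \<Rightarrow> real"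
  assumes x: "\<And>i. i \<in> {1..n} \<Longrightarrow> 0 \<le> x i"
    and a: "\<And>i. i \<in> {1..n} \<Longrightarrow> a i \<in> {1..n}"
    and feas: "\<And>i. i \<in> {1..n} \<Longrightarrow> load a x (i - 1) (a i) \<le> 1"
  shows "card {i\<in>{1..n}. x i + load a x (i - 1) (a i) > 1} \<le> card {j\<in>{1..n}. load a x n j > 1}"
proof (rule card_inj_on_le)
  have load_mono: "load a x k j \<le> load a x m j" if "k \<le> m" "m \<le> n" for k m j
    unfolding load_def using that x by (intro sum_mono2) auto
  have load_step: "load a x i (a i) = x i + load a x (i - 1) (a i)" if "i \<in> {1..n}" for i
  proof -
    have "{l\<in>{1..i}. a l = a i} = insert i {l\<in>{1..i - 1}. a l = a i}"
      using that by auto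
    moreover have "i \<notin> {l\<in>{1..i - 1}. a l = a i}" using that by auto
    ultimately show ?thesis unfolding load_def by simp
  qed
  show "inj_on a {i\<in>{1..n}. x i + load a x (i - 1) (a i) > 1}"
  proof (rule linorder_inj_onI)
    fix i k assume ik: "i < k" "i \<in> {i\<in>{1..n}. x i + load a x (i - 1) (a i) > 1}"
      "k \<in> {i\<in>{1..n}. x i + load a x (i - 1) (a i) > 1}"
    show "a i \<noteq> a k"
    proof
      assume eq: "a i = a k"
      have "load a x i (a i) > 1" using ik load_step[of i] by auto
      also have "load a x i (a i) \<le> load a x (k - 1) (a k)"
        unfolding eq using ik by (intro load_mono) auto
      also have "\<dots> \<le> 1" using feas[of k] ik by auto
      finally show False by simp
    qed
  qed auto
  show "a ` {i\<in>{1..n}. x i + load a x (i - 1) (a i) > 1} \<subseteq> {j\<in>{1..n}. load a x n j > 1}"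
  proof (intro image_subsetI CollectI conjI)
    fix i assume "i \<in> {i\<in>{1..n}. x i + load a x (i - 1) (a i) > 1}"
    then have i: "i \<in> {1..n}" "x i + load a x (i - 1) (a i) > 1" by auto
    show "a i \<in> {1..n}" using a[OF i(1)] .
    show "load a x n (a i) > 1"
      using load_mono[of i n "a i"] load_step[OF i(1)] i by auto
  qed
qed simp

text \<open>
  Fubini for the joint distribution of independent \<open>Y\<close> and \<open>U\<close>: the probability over \<open>Y\<close> alone,
  averaged over \<open>U\<close>, is the joint probability.
\<close>

lemma (in prob_space) expectation_prob_sum_gt:
  fixes Y U :: "'a \<Rightarrow> real"
  assumes indep: "indep_var borel Y borel U"
  shows "expectation (\<lambda>\<omega>. prob {\<omega>'\<in>space M. Y \<omega>' + U \<omega> > t}) = prob {\<omega>\<in>space M. Y \<omega> + U \<omega> > t}"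
proof -
  have [measurable]: "Y \<in> borel_measurable M" "U \<in> borel_measurable M"
    using indep_var_rv1[OF indep] indep_var_rv2[OF indep] by auto
  interpret DY: prob_space "distr M borel Y" by (intro prob_space_distr) simp
  interpret DU: prob_space "distr M borel U" by (intro prob_space_distr) simp
  interpret YU: pair_prob_space "distr M borel Y" "distr M borel U" ..
  define A where "A = {p :: real \<times> real. fst p + snd p > t}"
  have A: "A \<in> sets (borel \<Otimes>\<^sub>M borel)"
  proof -
    have "{p\<in>space (borel \<Otimes>\<^sub>M borel). fst p + snd p > t} \<in> sets (borel \<Otimes>\<^sub>M (borel :: real measure))"
      by measurable
    then show ?thesis unfolding A_def by (simp add: space_pair_measure)
  qed
  have mono: "mono (\<lambda>u. prob {\<omega>'\<in>space M. Y \<omega>' + u > t})"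
    by (intro monoI finite_measure_mono) auto
  have [measurable]: "(\<lambda>\<omega>. prob {\<omega>'\<in>space M. Y \<omega>' + U \<omega> > t}) \<in> borel_measurable M"
    using measurable_compose[OF \<open>U \<in> borel_measurable M\<close> borel_measurable_mono[OF mono]] .
  have "emeasure M {\<omega>\<in>space M. Y \<omega> + U \<omega> > t}
      = emeasure (distr M (borel \<Otimes>\<^sub>M borel) (\<lambda>\<omega>. (Y \<omega>, U \<omega>))) A"
    using A by (subst emeasure_distr) (auto simp: A_def intro!: arg_cong[where f="emeasure M"])
  also have "\<dots> = emeasure (distr M borel Y \<Otimes>\<^sub>M distr M borel U) A"
    using indep by (simp add: indep_var_distribution_eq)
  also have "\<dots> = (\<integral>\<^sup>+u. emeasure (distr M borel Y) ((\<lambda>y. (y, u)) -` A) \<partial>distr M borel U)"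
    using A by (intro YU.emeasure_pair_measure_alt2) simp
  also have "\<dots> = (\<integral>\<^sup>+u. ennreal (prob {\<omega>'\<in>space M. Y \<omega>' + u > t}) \<partial>distr M borel U)"
  proof (rule nn_integral_cong)
    fix u
    have e: "(\<lambda>y. (y, u)) -` A = {y. y + u > t}" by (auto simp: A_def)
    have "{y. y + u > t} \<in> sets borel" by measurable
    then show "emeasure (distr M borel Y) ((\<lambda>y. (y, u)) -` A)
        = ennreal (prob {\<omega>'\<in>space M. Y \<omega>' + u > t})"
      unfolding e by (subst emeasure_distr)
        (auto simp: emeasure_eq_measure intro!: arg_cong[where f="prob"])
  qed
  also have "\<dots> = (\<integral>\<^sup>+\<omega>. ennreal (prob {\<omega>'\<in>space M. Y \<omega>' + U \<omega> > t}) \<partial>M)"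
    using borel_measurable_mono[OF mono] by (intro nn_integral_distr) auto
  also have "\<dots> = ennreal (expectation (\<lambda>\<omega>. prob {\<omega>'\<in>space M. Y \<omega>' + U \<omega> > t}))"
    by (intro nn_integral_eq_integral integrable_const_bound[where B=1]) auto
  finally show ?thesis
    by (simp add: emeasure_eq_measure ennreal_inj integral_nonneg)
qed

section \<open>Measurability of packings\<close>

lemma usage_eq_load: "usage P x k j = load (bin_of P x) x k j"
  unfolding usage_def load_def ..

lemma bin_of_cong:
  assumes "\<And>k. k \<in> {1..<i} \<Longrightarrow> x k = y k"
  shows "bin_of P x i = bin_of P y i"
  using assms
proof (induction i rule: less_induct)
  case (less i)
  have "restrict (bin_of P x) {1..<i} = restrict (bin_of P y) {1..<i}"
    using less by (intro restrict_ext less.IH) auto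
  moreover have "restrict x {1..<i} = restrict y {1..<i}"
    using less.prems by (intro restrict_ext) auto
  ultimately show ?case by (simp add: bin_of.simps)
qed

text \<open>
  The sizes are arbitrary measurable functions on an arbitrary space \<open>N\<close>, so that the same lemma applies
  to the random items on \<open>M\<close>, to the history space when \<open>P\<close> is simulated inside another policy, and to
  the product space of the sizes when independence is used.
\<close>

lemma measurable_bin_of:
  assumes "is_policy n P" and "i \<in> {1..n}"
    and "\<And>k. k \<in> {1..<i} \<Longrightarrow> f k \<in> borel_measurable N"
  shows "(\<lambda>w. bin_of P (\<lambda>k. f k w) i) \<in> N \<rightarrow>\<^sub>M count_space {1..n}"
  using assms(2,3)
proof (induction i rule: less_induct)
  case (less i)
  have "(\<lambda>w. bin_of P (\<lambda>k. f k w) k) \<in> N \<rightarrow>\<^sub>M count_space {1..n}" if "k \<in> {1..<i}" for k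
    using less that by (intro less.IH) auto
  then have "(\<lambda>w. (\<lambda>k\<in>{1..<i}. bin_of P (\<lambda>k. f k w) k, \<lambda>k\<in>{1..<i}. f k w))
      \<in> N \<rightarrow>\<^sub>M history_space n i"
    unfolding history_space_def using less.prems
    by (intro measurable_Pair measurable_restrict) auto
  moreover have "P i \<in> history_space n i \<rightarrow>\<^sub>M count_space {1..n}"
    using assms(1) less.prems by (auto simp: is_policy_def)
  ultimately show ?case
    by (subst bin_of.simps) (rule measurable_compose)
qed

lemma measurable_bin_of_UNIV:
  assumes "is_policy n P" and "i \<in> {1..n}"
    and "\<And>k. k \<in> {1..<i} \<Longrightarrow> f k \<in> borel_measurable N"
  shows "(\<lambda>w. bin_of P (\<lambda>k. f k w) i) \<in> N \<rightarrow>\<^sub>M count_space UNIV"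
  using measurable_compose[OF measurable_bin_of[OF assms], where g="\<lambda>j. j" and L="count_space UNIV"]
  by simp

lemma bin_of_range:
  assumes "is_policy n P" and "i \<in> {1..n}"
  shows "bin_of P x i \<in> {1..n}"
proof -
  have "(\<lambda>_::unit. bin_of P x i) \<in> count_space UNIV \<rightarrow>\<^sub>M count_space {1..n}"
    \<comment> \<open>On a discrete space every size is measurable, so the codomain bound becomes a pointwise one.\<close>
    using measurable_bin_of[OF assms, where f="\<lambda>k _. x k" and N="count_space UNIV"] by simp
  from measurable_space[OF this, of "()"] show ?thesis by simp
qed

lemma measurable_load:
  assumes "\<And>l. l \<in> {1..k} \<Longrightarrow> (\<lambda>w. b w l) \<in> N \<rightarrow>\<^sub>M count_space UNIV"
    and "\<And>l. l \<in> {1..k} \<Longrightarrow> f l \<in> borel_measurable N"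
  shows "(\<lambda>w. load (b w) (\<lambda>l. f l w) k j) \<in> borel_measurable N"
proof -
  have "load (b w) (\<lambda>l. f l w) k j = (\<Sum>l\<in>{1..k}. if b w l = j then f l w else 0)" for w
    unfolding load_def by (rule sum.inter_filter) simp
  moreover have "(\<lambda>w. if b w l = j then f l w else 0) \<in> borel_measurable N" if "l \<in> {1..k}" for l
  proof -
    note [measurable] = assms(1)[OF that] assms(2)[OF that]
    show ?thesis by measurable
  qed
  ultimately show ?thesis by (simp add: borel_measurable_sum)
qed

lemma measurable_usage:
  assumes P: "is_policy n P" and k: "k \<le> n"
    and f: "\<And>l. l \<in> {1..k} \<Longrightarrow> f l \<in> borel_measurable N"
    and J: "J \<in> N \<rightarrow>\<^sub>M count_space UNIV"
  shows "(\<lambda>w. usage P (\<lambda>l. f l w) k (J w)) \<in> borel_measurable N"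
proof -
  have "(\<lambda>w. bin_of P (\<lambda>l. f l w) l) \<in> N \<rightarrow>\<^sub>M count_space UNIV" if "l \<in> {1..k}" for l
    using that k by (intro measurable_bin_of_UNIV[OF P] f) auto
  then have "(\<lambda>w. usage P (\<lambda>l. f l w) k j) \<in> borel_measurable N" for j
    unfolding usage_eq_load using f by (rule measurable_load)
  then show ?thesis using J by (rule measurable_compose_countable)
qed

text \<open>
  The history of \<open>split_policy q r P\<close> records the chosen sub-bins as its first component. The bins
  chosen by \<open>P\<close> are not recorded; they are recomputed from the sizes by running \<open>P\<close>.
\<close>

definition split_policy :: "(nat \<Rightarrow> real \<Rightarrow> real) \<Rightarrow> real \<Rightarrow> policy \<Rightarrow> policy" where
  "split_policy q r P i h = next_fit q r i (restrict (bin_of P (snd h)) {1..i}) (fst h) (snd h)"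

lemma bin_of_split_policy:
  assumes "1 \<le> i"
  shows "bin_of (split_policy q r P) x i
    = next_fit q r i (bin_of P x) (bin_of (split_policy q r P) x) x"
  by (subst bin_of.simps)
    (auto simp: split_policy_def intro!: next_fit_cong bin_of_cong assms)

text \<open>
  For fixed assignments \<open>\<alpha>\<close> and \<open>\<beta>\<close> only the comparison of a risk with \<open>r\<close> still depends on the sizes.
\<close>

lemma measurable_next_fit:
  assumes i: "i \<in> {1..n}"
    and \<beta>: "\<beta> \<in> {1..<i} \<rightarrow> {1..n}"
    and q: "\<And>k. k \<in> {1..n} \<Longrightarrow> q k \<in> borel_measurable borel"
    and f: "\<And>k. k \<in> {1..<i} \<Longrightarrow> f k \<in> borel_measurable N"
  shows "(\<lambda>w. next_fit q r i \<alpha> \<beta> (\<lambda>k. f k w)) \<in> N \<rightarrow>\<^sub>M count_space {1..n}"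
proof -
  define F where "F = {k\<in>{1..<i}. q k 0 \<le> r \<and> \<alpha> k = \<alpha> i}"
  define c where "c = \<beta> (Max F)"
  define R where "R w = (\<Sum>k\<in>{k\<in>{1..<i}. \<beta> k = c}. q k (load \<beta> (\<lambda>k. f k w) (k - 1) c))
      + q i (load \<beta> (\<lambda>k. f k w) (i - 1) c)" for w
  have eq: "next_fit q r i \<alpha> \<beta> (\<lambda>k. f k w) = (if q i 0 \<le> r \<and> F \<noteq> {} \<and> R w \<le> r then c else i)" for w
    unfolding next_fit_def F_def[symmetric] Let_def R_def c_def ..
  show ?thesis
  proof (cases "q i 0 \<le> r \<and> F \<noteq> {}")
    case True
    have "Max F \<in> F" using True by (intro Max_in) (auto simp: F_def)
    then have c: "c \<in> {1..n}" using \<beta> by (auto simp: F_def c_def)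
    have "(\<lambda>w. load \<beta> (\<lambda>k. f k w) (k - 1) c) \<in> borel_measurable N" if "k \<in> {1..i}" for k
      by (rule measurable_load) (use that f in auto)
    then have L: "(\<lambda>w. q k (load \<beta> (\<lambda>k. f k w) (k - 1) c)) \<in> borel_measurable N"
      if "k \<in> {1..i}" for k
      using that i by (intro measurable_compose[OF _ q]) auto
    have [measurable]: "R \<in> borel_measurable N"
      unfolding R_def using i by (intro borel_measurable_add borel_measurable_sum L) auto
    show ?thesis unfolding eq using True c i by simp
  next
    case False
    then show ?thesis unfolding eq using i by auto
  qed
qed

text \<open>
  Only finitely many assignments of the first \<open>i\<close> items to bins are possible. Measurability can thus be
  checked for each fixed pair of assignments, and the pieces are glued along the measurable maps
  that give the actual assignments.
\<close>

lemma is_policy_split_policy: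
  assumes P: "is_policy n P"
    and q: "\<And>k. k \<in> {1..n} \<Longrightarrow> q k \<in> borel_measurable borel"
  shows "is_policy n (split_policy q r P)"
  unfolding is_policy_def
proof
  fix i assume i: "i \<in> {1..n}"
  let ?H = "history_space n i"
  have x: "(\<lambda>h. snd h k) \<in> borel_measurable ?H" if "k \<in> {1..<i}" for k
    unfolding history_space_def using that
    by (intro measurable_compose[OF measurable_snd measurable_component_singleton])
  have A: "(\<lambda>h. restrict (bin_of P (snd h)) {1..i}) \<in> ?H \<rightarrow>\<^sub>M count_space ({1..i} \<rightarrow>\<^sub>E {1..n})"
  proof -
    have "(\<lambda>h. restrict (bin_of P (snd h)) {1..i}) \<in> ?H \<rightarrow>\<^sub>M PiM {1..i} (\<lambda>_. count_space {1..n})"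
      using i x by (intro measurable_restrict measurable_bin_of[OF P]) auto
    then show ?thesis by (simp add: count_space_PiM_finite)
  qed
  have B: "fst \<in> ?H \<rightarrow>\<^sub>M count_space ({1..<i} \<rightarrow>\<^sub>E {1..n})"
  proof -
    have "fst \<in> ?H \<rightarrow>\<^sub>M PiM {1..<i} (\<lambda>_. count_space {1..n})"
      unfolding history_space_def by (rule measurable_fst)
    then show ?thesis by (simp add: count_space_PiM_finite)
  qed
  have fixed: "(\<lambda>h. next_fit q r i \<alpha> \<beta> (snd h)) \<in> ?H \<rightarrow>\<^sub>M count_space {1..n}"
    if "\<beta> \<in> {1..<i} \<rightarrow>\<^sub>E {1..n}" for \<alpha> \<beta>
    using that by (intro measurable_next_fit[where f="\<lambda>k h. snd h k"] i q x) auto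
  have "(\<lambda>h. next_fit q r i \<alpha> (fst h) (snd h)) \<in> ?H \<rightarrow>\<^sub>M count_space {1..n}" for \<alpha>
    by (rule measurable_compose_countable'[OF fixed B])
      (auto intro!: countable_finite finite_PiE)
  then show "split_policy q r P i \<in> ?H \<rightarrow>\<^sub>M count_space {1..n}"
    unfolding split_policy_def
    by (rule measurable_compose_countable'[OF _ A]) (auto intro!: countable_finite finite_PiE)
qed

lemma measurable_num_opened:
  assumes P: "is_policy n P"
    and f: "\<And>k. k \<in> {1..n} \<Longrightarrow> f k \<in> borel_measurable N"
  shows "(\<lambda>w. real (num_opened n P (\<lambda>k. f k w))) \<in> borel_measurable N"
proof -
  have b: "(\<lambda>w. bin_of P (\<lambda>k. f k w) i) \<in> N \<rightarrow>\<^sub>M count_space UNIV" if "i \<in> {1..n}" for i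
    using that by (intro measurable_bin_of_UNIV[OF P] f) auto
  have "Measurable.pred N (\<lambda>w. bin_of P (\<lambda>k. f k w) i = j)" if "i \<in> {1..n}" for i j
    using b[OF that] by measurable
  then have "Measurable.pred N (\<lambda>w. \<exists>i\<in>{1..n}. bin_of P (\<lambda>k. f k w) i = j)" for j
    by (intro pred_intros_finite) auto
  note pred = this[unfolded pred_def]
  have "real (num_opened n P x) = (\<Sum>j\<in>{1..n}. if \<exists>i\<in>{1..n}. bin_of P x i = j then 1 else 0)" for x
    unfolding num_opened_def by (simp flip: sum.inter_filter)
  then show ?thesis
    by (simp only:) (intro borel_measurable_sum measurable_If pred borel_measurable_const)
qed

lemma measurable_num_overflowed:
  assumes P: "is_policy n P"
    and f: "\<And>k. k \<in> {1..n} \<Longrightarrow> f k \<in> borel_measurable N"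
  shows "(\<lambda>w. real (num_overflowed n P (\<lambda>k. f k w))) \<in> borel_measurable N"
proof -
  have [measurable]: "(\<lambda>w. usage P (\<lambda>k. f k w) n j) \<in> borel_measurable N" for j
    using f by (intro measurable_usage[OF P]) auto
  have "real (num_overflowed n P x) = (\<Sum>j\<in>{1..n}. if usage P x n j > 1 then 1 else 0)" for x
    unfolding num_overflowed_def by (simp flip: sum.inter_filter)
  then show ?thesis by simp
qed

lemma card_filter_le: "card {j\<in>{1..n}. Q j} \<le> n"
  using card_mono[of "{1..n}" "{j\<in>{1..n}. Q j}"] by (metis (no_types, lifting) card_atLeastAtMost
      diff_Suc_1 finite_atLeastAtMost mem_Collect_eq subsetI)

lemma num_opened_le: "num_opened n P x \<le> n"
  unfolding num_opened_def by (rule card_filter_le)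

lemma num_overflowed_le: "num_overflowed n P x \<le> n"
  unfolding num_overflowed_def by (rule card_filter_le)

section \<open>The cost of splitting\<close>

lemma (in prob_space) integrable_opened_overflowed:
  assumes "is_policy n P" and "\<And>k. k \<in> {1..n} \<Longrightarrow> random_variable borel (X k)"
  shows "integrable M (\<lambda>\<omega>. real (num_opened n P (\<lambda>k. X k \<omega>)))"
    and "integrable M (\<lambda>\<omega>. real (num_overflowed n P (\<lambda>k. X k \<omega>)))"
  using measurable_num_opened[OF assms] measurable_num_overflowed[OF assms]
  by (auto intro!: integrable_const_bound[where B=n] simp: num_opened_le num_overflowed_le)

abbreviation (in prob_space) overflow_prob :: "(nat \<Rightarrow> 'a \<Rightarrow> real) \<Rightarrow> nat \<Rightarrow> real \<Rightarrow> real" where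
  "overflow_prob X i u \<equiv> prob {\<omega>\<in>space M. X i \<omega> + u > 1}"

lemma (in prob_space) overflow_prob_mono:
  assumes "random_variable borel (X i)" and "u \<le> v"
  shows "overflow_prob X i u \<le> overflow_prob X i v"
  using assms by (intro finite_measure_mono) auto

lemma (in prob_space) measurable_overflow_prob:
  assumes "random_variable borel (X i)"
  shows "overflow_prob X i \<in> borel_measurable borel"
  using overflow_prob_mono[of X i] assms by (intro borel_measurable_mono monoI) auto

text \<open>
  The load that item \<open>i\<close> meets is a function of the sizes of the earlier items, hence independent of its
  own size. The expected risk of item \<open>i\<close> is therefore the probability that it makes its bin overflow.
\<close>

lemma (in prob_space) expected_risk_le_expected_overflow:
  assumes indep: "indep_vars (\<lambda>_. borel) X {1..n}"
    and nonneg: "\<And>i \<omega>. i \<in> {1..n} \<Longrightarrow> \<omega> \<in> space M \<Longrightarrow> 0 \<le> X i \<omega>"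
    and P: "is_policy n P"
    and feas: "feasible M X n P"
  defines "U i \<omega> \<equiv> usage P (\<lambda>k. X k \<omega>) (i - 1) (bin_of P (\<lambda>k. X k \<omega>) i)"
  shows "integrable M (\<lambda>\<omega>. \<Sum>i\<in>{1..n}. overflow_prob X i (U i \<omega>))"
    and "expectation (\<lambda>\<omega>. \<Sum>i\<in>{1..n}. overflow_prob X i (U i \<omega>))
      \<le> expectation (\<lambda>\<omega>. real (num_overflowed n P (\<lambda>k. X k \<omega>)))"
proof -
  have X: "random_variable borel (X i)" if "i \<in> {1..n}" for i
    using indep that unfolding indep_vars_def2 by auto
  have U: "random_variable borel (U i)" if "i \<in> {1..n}" for i
    unfolding U_def using that
    by (intro measurable_usage[OF P] measurable_bin_of_UNIV[OF P] X) auto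
  have int: "integrable M (\<lambda>\<omega>. overflow_prob X i (U i \<omega>))" if "i \<in> {1..n}" for i
    using measurable_compose[OF U[OF that] measurable_overflow_prob[of X i, OF X[OF that]]]
    by (intro integrable_const_bound[where B=1]) auto
  then show "integrable M (\<lambda>\<omega>. \<Sum>i\<in>{1..n}. overflow_prob X i (U i \<omega>))"
    by (rule Bochner_Integration.integrable_sum)
  have crossing: "expectation (\<lambda>\<omega>. overflow_prob X i (U i \<omega>))
      = expectation (indicator {\<omega>\<in>space M. X i \<omega> + U i \<omega> > 1})" if i: "i \<in> {1..n}" for i
  proof -
    \<comment> \<open>\<open>g\<close> computes the load met by item \<open>i\<close> from the sizes of the items before \<open>i\<close>.\<close>
    define g where "g y = usage P y (i - 1) (bin_of P y i)" for y
    have "g \<in> PiM {1..<i} (\<lambda>_. borel) \<rightarrow>\<^sub>M borel"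
      unfolding g_def using i
      by (intro measurable_usage[OF P, where f="\<lambda>k y. y k"]
          measurable_bin_of_UNIV[OF P, where f="\<lambda>k y. y k"] measurable_component_singleton) auto
    moreover have "indep_var (PiM {i} (\<lambda>_. borel)) (\<lambda>\<omega>. restrict (\<lambda>k. X k \<omega>) {i})
        (PiM {1..<i} (\<lambda>_. borel)) (\<lambda>\<omega>. restrict (\<lambda>k. X k \<omega>) {1..<i})"
      using i by (intro indep_var_restrict[OF indep]) auto
    ultimately have "indep_var borel ((\<lambda>y. y i) \<circ> (\<lambda>\<omega>. restrict (\<lambda>k. X k \<omega>) {i}))
        borel (g \<circ> (\<lambda>\<omega>. restrict (\<lambda>k. X k \<omega>) {1..<i}))"
      by (intro indep_var_compose[where ?M1.0="PiM {i} (\<lambda>_. borel)"]) auto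
    moreover have "(\<lambda>y. y i) \<circ> (\<lambda>\<omega>. restrict (\<lambda>k. X k \<omega>) {i}) = X i" by auto
    moreover have "g (restrict (\<lambda>k. X k \<omega>) {1..<i}) = U i \<omega>" for \<omega>
    proof -
      have "i \<in> {1..i}" using i by simp
      have b: "bin_of P (restrict (\<lambda>k. X k \<omega>) {1..<i}) k = bin_of P (\<lambda>k. X k \<omega>) k"
        if "k \<in> {1..i}" for k
        using that by (intro bin_of_cong) auto
      show ?thesis
        unfolding g_def U_def usage_eq_load b[OF \<open>i \<in> {1..i}\<close>]
        by (rule load_cong) (auto intro!: bin_of_cong)
    qed
    then have "g \<circ> (\<lambda>\<omega>. restrict (\<lambda>k. X k \<omega>) {1..<i}) = U i" by auto
    ultimately have "indep_var borel (X i) borel (U i)" by metis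
    moreover have "{\<omega>\<in>space M. X i \<omega> + U i \<omega> > 1} \<inter> space M = {\<omega>\<in>space M. X i \<omega> + U i \<omega> > 1}"
      by blast
    ultimately show ?thesis by (simp add: expectation_prob_sum_gt)
  qed
  have ind_int: "integrable M (indicator {\<omega>\<in>space M. X i \<omega> + U i \<omega> > 1} :: 'a \<Rightarrow> real)"
    if "i \<in> {1..n}" for i
  proof -
    note [measurable] = X[OF that] U[OF that]
    show ?thesis by (intro integrable_const_bound[where B=1]) auto
  qed
  have "expectation (\<lambda>\<omega>. \<Sum>i\<in>{1..n}. overflow_prob X i (U i \<omega>))
      = (\<Sum>i\<in>{1..n}. expectation (\<lambda>\<omega>. overflow_prob X i (U i \<omega>)))"
    using int by (rule Bochner_Integration.integral_sum)
  also have "\<dots> = (\<Sum>i\<in>{1..n}. expectation (indicator {\<omega>\<in>space M. X i \<omega> + U i \<omega> > 1}))"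
    using crossing by (rule sum.cong[OF refl])
  also have "\<dots> = expectation (\<lambda>\<omega>. \<Sum>i\<in>{1..n}. indicator {\<omega>\<in>space M. X i \<omega> + U i \<omega> > 1} \<omega>)"
    using ind_int by (rule Bochner_Integration.integral_sum[symmetric])
  also have "\<dots> \<le> expectation (\<lambda>\<omega>. real (num_overflowed n P (\<lambda>k. X k \<omega>)))"
  proof (rule integral_mono)
    show "integrable M (\<lambda>\<omega>. \<Sum>i\<in>{1..n}. indicator {\<omega>\<in>space M. X i \<omega> + U i \<omega> > 1} \<omega> :: real)"
      using ind_int by (rule Bochner_Integration.integrable_sum)
    show "integrable M (\<lambda>\<omega>. real (num_overflowed n P (\<lambda>k. X k \<omega>)))"
      using integrable_opened_overflowed(2)[OF P X] .
    fix \<omega> assume \<omega>: "\<omega> \<in> space M"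
    have "(\<Sum>i\<in>{1..n}. indicator {\<omega>\<in>space M. X i \<omega> + U i \<omega> > 1} \<omega>)
        = (\<Sum>i\<in>{1..n}. if X i \<omega> + U i \<omega> > 1 then 1 else (0 :: real))"
      using \<omega> by (intro sum.cong) (auto simp: indicator_def)
    also have "\<dots> = real (card {i\<in>{1..n}. X i \<omega> + U i \<omega> > 1})"
      by (simp flip: sum.inter_filter)
    also have "\<dots> \<le> real (num_overflowed n P (\<lambda>k. X k \<omega>))"
      unfolding num_overflowed_def U_def usage_eq_load of_nat_le_iff
      using feas \<omega> bin_of_range[OF P] nonneg
      by (intro crossings_le_overflowed) (auto simp: feasible_def usage_eq_load not_less)
    finally show "(\<Sum>i\<in>{1..n}. indicator {\<omega>\<in>space M. X i \<omega> + U i \<omega> > 1} \<omega>)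
        \<le> real (num_overflowed n P (\<lambda>k. X k \<omega>))" .
  qed
  finally show "expectation (\<lambda>\<omega>. \<Sum>i\<in>{1..n}. overflow_prob X i (U i \<omega>))
      \<le> expectation (\<lambda>\<omega>. real (num_overflowed n P (\<lambda>k. X k \<omega>)))" .
qed

theorem theorem1p1:
  fixes M :: "'a measure" and X :: "nat \<Rightarrow> 'a \<Rightarrow> real" and n :: nat
    and C \<gamma> :: real and P :: policy
  assumes "prob_space M"
    and "prob_space.indep_vars M (\<lambda>_. borel) X {1..n}"
    and "\<And>i \<omega>. i \<in> {1..n} \<Longrightarrow> \<omega> \<in> space M \<Longrightarrow> 0 \<le> X i \<omega>"
    and "C \<ge> 1"
    and "\<gamma> > 0"
    and "is_policy n P"
    and "feasible M X n P"
  shows "\<exists>P'. is_policy n P' \<and> feasible M X n P' \<and>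
    (\<forall>\<omega>\<in>space M. \<forall>i\<in>{1..n}. \<P>(\<omega>' in M. X i \<omega>' > 1) > \<gamma> / C \<longrightarrow>
       (\<forall>k\<in>{1..n}. k \<noteq> i \<longrightarrow> bin_of P' (\<lambda>l. X l \<omega>) k \<noteq> bin_of P' (\<lambda>l. X l \<omega>) i)) \<and>
    (\<forall>\<omega>\<in>space M. \<forall>j\<in>{1..n}.
       \<not> (\<exists>i\<in>{1..n}. \<P>(\<omega>' in M. X i \<omega>' > 1) > \<gamma> / C \<and> bin_of P' (\<lambda>l. X l \<omega>) i = j) \<longrightarrow>
       risk M X n P' (\<lambda>l. X l \<omega>) j \<le> \<gamma> / C) \<and>
    ((\<forall>i\<in>{1..n}. \<P>(\<omega>' in M. X i \<omega>' > 1) \<le> \<gamma> / C) \<longrightarrow> risk_budgeted M X n (\<gamma> / C) P') \<and>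
    cost M X n C P' \<le> (1 + 2 / \<gamma>) * cost M X n C P"
proof -
  interpret prob_space M by fact
  have X: "random_variable borel (X i)" if "i \<in> {1..n}" for i
    using assms(2) that unfolding indep_vars_def2 by auto
  define q where "q = overflow_prob X"
  define r where "r = \<gamma> / C"
  define P' where "P' = split_policy q r P"
  have r: "0 < r" using assms(4,5) by (simp add: r_def)
  have P': "is_policy n P'"
    unfolding P'_def q_def by (intro is_policy_split_policy assms measurable_overflow_prob X)
  have splitting: "next_fit_splitting n (bin_of P (\<lambda>k. X k \<omega>)) (bin_of P' (\<lambda>k. X k \<omega>)) (\<lambda>k. X k \<omega>) q r"
    if "\<omega> \<in> space M" for \<omega>
  proof
    fix i assume "i \<in> {1..n}"
    then show "bin_of P' (\<lambda>k. X k \<omega>) i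
        = next_fit q r i (bin_of P (\<lambda>k. X k \<omega>)) (bin_of P' (\<lambda>k. X k \<omega>)) (\<lambda>k. X k \<omega>)"
      unfolding P'_def by (intro bin_of_split_policy) auto
  qed (use that r assms(3) X overflow_prob_mono in \<open>auto simp: q_def\<close>)
  have feas: "load (bin_of P (\<lambda>k. X k \<omega>)) (\<lambda>k. X k \<omega>) (i - 1) (bin_of P (\<lambda>k. X k \<omega>) i) \<le> 1"
    if "\<omega> \<in> space M" "i \<in> {1..n}" for \<omega> i
    using assms(7) that unfolding feasible_def usage_eq_load not_less by blast
  have heavy_iff: "prob {\<omega>'\<in>space M. X i \<omega>' > 1} > \<gamma> / C \<longleftrightarrow> q i 0 > r" for i
    by (simp add: q_def r_def)

  have feas': "feasible M X n P'"
    unfolding feasible_def usage_eq_load not_less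
  proof (intro ballI)
    fix \<omega> i assume \<omega>: "\<omega> \<in> space M" and i: "i \<in> {1..n}"
    interpret next_fit_splitting n "bin_of P (\<lambda>k. X k \<omega>)" "bin_of P' (\<lambda>k. X k \<omega>)" "\<lambda>k. X k \<omega>" q r
      by (rule splitting[OF \<omega>])
    have "i - 1 \<le> n" using i by auto
    from load_refine[OF this i] feas[OF \<omega> i]
    show "load (bin_of P' (\<lambda>k. X k \<omega>)) (\<lambda>k. X k \<omega>) (i - 1) (bin_of P' (\<lambda>k. X k \<omega>) i) \<le> 1"
      by (rule order_trans)
  qed
  have alone: "bin_of P' (\<lambda>l. X l \<omega>) k \<noteq> bin_of P' (\<lambda>l. X l \<omega>) i"
    if "\<omega> \<in> space M" "i \<in> {1..n}" "q i 0 > r" "k \<in> {1..n}" "k \<noteq> i" for \<omega> i k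
    using next_fit_splitting.heavy_alone[OF splitting] that by blast
  have risk_le: "risk M X n P' (\<lambda>l. X l \<omega>) j \<le> r"
    if \<omega>: "\<omega> \<in> space M" and j: "\<not> (\<exists>i\<in>{1..n}. q i 0 > r \<and> bin_of P' (\<lambda>l. X l \<omega>) i = j)" for \<omega> j
  proof -
    let ?b = "bin_of P' (\<lambda>l. X l \<omega>)"
    have "risk M X n P' (\<lambda>l. X l \<omega>) j
        = (\<Sum>k\<in>{1..n}. if ?b k = j then q k (load ?b (\<lambda>l. X l \<omega>) (k - 1) j) else 0)"
      unfolding risk_def q_def usage_eq_load by (intro sum.cong) auto
    also have "\<dots> = (\<Sum>k\<in>{k\<in>{1..n}. ?b k = j}. q k (load ?b (\<lambda>l. X l \<omega>) (k - 1) j))"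
      by (rule sum.inter_filter[symmetric]) simp
    also have "\<dots> \<le> r"
      using j by (intro next_fit_splitting.risk_sub_bin[OF splitting[OF \<omega>]]) (auto simp: not_less)
    finally show ?thesis .
  qed

  define opened where "opened Q \<omega> = real (num_opened n Q (\<lambda>k. X k \<omega>))" for Q \<omega>
  define overflowed where "overflowed Q \<omega> = real (num_overflowed n Q (\<lambda>k. X k \<omega>))" for Q \<omega>
  define \<rho> where "\<rho> \<omega> = (\<Sum>i\<in>{1..n}. overflow_prob X i
      (usage P (\<lambda>k. X k \<omega>) (i - 1) (bin_of P (\<lambda>k. X k \<omega>) i)))" for \<omega>
  have cost_eq: "cost M X n C Q = expectation (opened Q) + C * expectation (overflowed Q)" for Q
    unfolding cost_def opened_def overflowed_def ..
  have int: "integrable M (opened Q)" "integrable M (overflowed Q)" if "is_policy n Q" for Q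
    using integrable_opened_overflowed[OF that X] unfolding opened_def overflowed_def by auto
  have \<rho>: "integrable M \<rho>" "expectation \<rho> \<le> expectation (overflowed P)"
    using expected_risk_le_expected_overflow[OF assms(2,3,6,7)]
    unfolding \<rho>_def overflowed_def by auto

  have "opened P' \<omega> \<le> opened P \<omega> + 2 / r * \<rho> \<omega>" if \<omega>: "\<omega> \<in> space M" for \<omega>
  proof -
    interpret next_fit_splitting n "bin_of P (\<lambda>k. X k \<omega>)" "bin_of P' (\<lambda>k. X k \<omega>)" "\<lambda>k. X k \<omega>" q r
      by (rule splitting[OF \<omega>])
    have opened_eq: "opened Q \<omega> = card (bin_of Q (\<lambda>k. X k \<omega>) ` {1..n})" if "is_policy n Q" for Q
    proof -
      have "{j\<in>{1..n}. \<exists>i\<in>{1..n}. bin_of Q (\<lambda>k. X k \<omega>) i = j} = bin_of Q (\<lambda>k. X k \<omega>) ` {1..n}"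
        using bin_of_range[OF that, of _ "\<lambda>k. X k \<omega>"] by blast
      then show ?thesis unfolding opened_def num_opened_def by simp
    qed
    have "r * opened P' \<omega> \<le> r * opened P \<omega> + 2 * \<rho> \<omega>"
      using open_count unfolding opened_eq[OF P'] opened_eq[OF assms(6)] image_b \<rho>_def q_def usage_eq_load .
    then show ?thesis using r_pos by (simp add: field_simps)
  qed
  then have "expectation (opened P') \<le> expectation (\<lambda>\<omega>. opened P \<omega> + 2 / r * \<rho> \<omega>)"
    using int[OF P'] int[OF assms(6)] \<rho> by (intro integral_mono) auto
  also have "\<dots> = expectation (opened P) + 2 / r * expectation \<rho>"
    using int[OF assms(6)] \<rho> by simp
  also have "\<dots> \<le> expectation (opened P) + 2 / r * expectation (overflowed P)"
    using \<rho>(2) r by (intro add_left_mono mult_left_mono) auto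
  finally have open_le: "expectation (opened P') \<le> expectation (opened P) + 2 / r * expectation (overflowed P)" .

  have "overflowed P' \<omega> \<le> overflowed P \<omega>" if \<omega>: "\<omega> \<in> space M" for \<omega>
    unfolding overflowed_def num_overflowed_def usage_eq_load of_nat_le_iff
    using feas[OF \<omega>] bin_of_range[OF assms(6)]
    by (intro next_fit_splitting.overflow_count[OF splitting[OF \<omega>]])
  then have over_le: "expectation (overflowed P') \<le> expectation (overflowed P)"
    using int[OF P'] int[OF assms(6)] by (intro integral_mono) auto

  have "0 \<le> expectation (opened P)"
    by (intro integral_nonneg_AE) (auto simp: opened_def)
  then have "0 \<le> 2 / \<gamma> * expectation (opened P)" using assms(5) by simp
  moreover have "2 / r = 2 / \<gamma> * C" by (simp add: r_def)
  moreover have "C * expectation (overflowed P') \<le> C * expectation (overflowed P)"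
    using over_le assms(4) by (intro mult_left_mono) auto
  ultimately have cost_le: "cost M X n C P' \<le> (1 + 2 / \<gamma>) * cost M X n C P"
    using open_le unfolding cost_eq by (simp add: algebra_simps)
  have budgeted: "risk_budgeted M X n r P'" if "\<forall>i\<in>{1..n}. \<not> q i 0 > r"
    unfolding risk_budgeted_def using r risk_le that by blast
  show ?thesis
    unfolding not_less[symmetric] heavy_iff
    unfolding r_def[symmetric] not_less
    by (intro exI[of _ P'] conjI P' feas' cost_le)
      (use alone risk_le budgeted in \<open>auto simp: not_less\<close>)
qed

end
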